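(* Let $(X,\mu)$ be a $\sigma$-finite measure space and $f_1,f_2\in L^2(X,\mu,\mathbb C)$. Then, for all $\lambda_1,\lambda_2\in\mathbb C$, we have $$\frac{|\lambda_1||\lambda_2|}{2}\int_{X\times X}\left|\det\begin{pmatrix}f_1(x)&f_2(x)\\ f_1(y)&f_2(y)\end{pmatrix}\right|^2d\mu(x)\,d\mu(y)\le \|f_1\|_{L^2(X)}\|f_2\|_{L^2(X)}\int_X|\lambda_1f_1+\lambda_2f_2|^2\,d\mu .$$
   Context: $\|f\|_{L^2(X)}=\left(\int_X|f|^2d\mu\right)^{1/2}$. *)

theory Defs
  imports "HOL-Analysis.Analysis"
begin

text \<open>
  Elements of \<open>L\<^sup>2(X, \<mu>, \<complex>)\<close> are given by measurable representatives;
  functions that agree almost everywhere are not identified.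
\<close>

definition L2_fun :: "'a measure \<Rightarrow> ('a \<Rightarrow> complex) set" where
  "L2_fun M = {f \<in> borel_measurable M. integrable M (\<lambda>x. (cmod (f x))\<^sup>2)}"

definition L2_norm :: "'a measure \<Rightarrow> ('a \<Rightarrow> complex) \<Rightarrow> real" where
  "L2_norm M f = sqrt (\<integral>x. (cmod (f x))\<^sup>2 \<partial>M)"

end

theory Submission imports Defs begin

text \<open>
  Write \<open>A = \<parallel>f\<^sub>1\<parallel>\<^sup>2\<close>, \<open>B = \<parallel>f\<^sub>2\<parallel>\<^sup>2\<close> and \<open>c\<close> for the inner product of \<open>f\<^sub>1\<close> and \<open>f\<^sub>2\<close>.
  The double integral equals \<open>2 (A B - \<bar>c\<bar>\<^sup>2)\<close>, and \<open>\<integral>\<bar>l\<^sub>1 f\<^sub>1 + l\<^sub>2 f\<^sub>2\<bar>\<^sup>2\<close> is at least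
  \<open>2 \<bar>l\<^sub>1\<bar> \<bar>l\<^sub>2\<bar> (\<surd>(A B) - \<bar>c\<bar>)\<close> by the arithmetic-geometric mean inequality. It remains to factor
  \<open>A B - \<bar>c\<bar>\<^sup>2\<close> as a difference of squares and to use \<open>\<bar>c\<bar> \<le> \<surd>(A B)\<close>, which follows from the
  double integral being nonnegative.
\<close>

lemma cmod_add_squared:
  fixes a b :: complex
  shows "(cmod (a + b))\<^sup>2 = (cmod a)\<^sup>2 + (cmod b)\<^sup>2 + 2 * Re (a * cnj b)"
  by (simp only: cmod_power2) (simp add: power2_eq_square algebra_simps)

text \<open>The cross term is grouped to separate variables: when \<open>a\<close>, \<open>b\<close>
  are values at \<open>x\<close> and \<open>c\<close>, \<open>d\<close> values at \<open>y\<close>,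
  it is a function of \<open>x\<close> times the conjugate of the same function at
  \<open>y\<close>.\<close>

lemma cmod_cross_squared:
  fixes a b c d :: complex
  shows "(cmod (a * d - b * c))\<^sup>2 =
    (cmod a)\<^sup>2 * (cmod d)\<^sup>2 + (cmod b)\<^sup>2 * (cmod c)\<^sup>2 - 2 * Re ((a * cnj b) * cnj (c * cnj d))"
  using cmod_add_squared[of "a * d" "- (b * c)"]
  by (simp add: norm_mult power_mult_distrib mult_ac)

text \<open>The product is dominated by half the sum of the two squares, which is
  integrable.\<close>

lemma integrable_mult_cnj_L2:
  assumes "f \<in> L2_fun M" and "g \<in> L2_fun M"
  shows "integrable M (\<lambda>x. f x * cnj (g x))"
proof (rule Bochner_Integration.integrable_bound)
  show "integrable M (\<lambda>x. ((cmod (f x))\<^sup>2 + (cmod (g x))\<^sup>2) / 2)"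
    using assms by (simp add: L2_fun_def)
  have [measurable]: "f \<in> borel_measurable M" "g \<in> borel_measurable M"
    using assms by (simp_all add: L2_fun_def)
  have "(\<lambda>x. cnj (g x)) \<in> borel_measurable M"
    by (rule borel_measurable_continuous_on[OF _ \<open>g \<in> borel_measurable M\<close>]) (intro continuous_intros)
  then show "(\<lambda>x. f x * cnj (g x)) \<in> borel_measurable M"
    by measurable
  have "norm (f x * cnj (g x)) \<le> norm (((cmod (f x))\<^sup>2 + (cmod (g x))\<^sup>2) / 2)" for x
    using sum_squares_bound[of "cmod (f x)" "cmod (g x)"]
    by (simp add: norm_mult)
  then show "AE x in M. norm (f x * cnj (g x)) \<le> norm (((cmod (f x))\<^sup>2 + (cmod (g x))\<^sup>2) / 2)"
    by simp
qed

text \<open>Fubini for a product of separate variables. Stating integrability and value together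
  lets sums and differences of such terms be integrated by composing rules.\<close>

lemma (in pair_sigma_finite) has_bochner_integral_product:
  fixes f :: "'a \<Rightarrow> 'c::{real_normed_field, banach, second_countable_topology}" and g :: "'b \<Rightarrow> 'c"
  assumes f: "integrable M1 f" and g: "integrable M2 g"
  shows "has_bochner_integral (M1 \<Otimes>\<^sub>M M2) (\<lambda>(x, y). f x * g y)
    (integral\<^sup>L M1 f * integral\<^sup>L M2 g)"
proof -
  have [measurable]: "f \<in> borel_measurable M1" "g \<in> borel_measurable M2"
    using f g by simp_all
  have "integrable (M1 \<Otimes>\<^sub>M M2) (\<lambda>(x, y). f x * g y)"
    by (rule Fubini_integrable) (use f g in \<open>simp_all add: norm_mult\<close>)
  moreover from this have "integral\<^sup>L (M1 \<Otimes>\<^sub>M M2) (\<lambda>(x, y). f x * g y) =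
      integral\<^sup>L M1 f * integral\<^sup>L M2 g"
    by (subst integral_fst'[symmetric]) simp_all
  ultimately show ?thesis
    by (simp add: has_bochner_integral_iff)
qed

text \<open>By \<open>cmod_cross_squared\<close> the integrand is a combination of three terms with
  separated variables, so each integral over the product space factors.\<close>

lemma integral_cmod_cross_squared:
  assumes "sigma_finite_measure M" and f: "f \<in> L2_fun M" and g: "g \<in> L2_fun M"
  shows "(\<integral>(x, y). (cmod (f x * g y - g x * f y))\<^sup>2 \<partial>(M \<Otimes>\<^sub>M M)) =
    2 * ((\<integral>x. (cmod (f x))\<^sup>2 \<partial>M) * (\<integral>x. (cmod (g x))\<^sup>2 \<partial>M)
      - (cmod (\<integral>x. f x * cnj (g x) \<partial>M))\<^sup>2)"
proof -
  interpret sigma_finite_measure M by fact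
  interpret pair_sigma_finite M M ..
  let ?c = "\<integral>x. f x * cnj (g x) \<partial>M"
  have F: "integrable M (\<lambda>x. (cmod (f x))\<^sup>2)" and G: "integrable M (\<lambda>x. (cmod (g x))\<^sup>2)"
    using f g by (simp_all add: L2_fun_def)
  have C: "integrable M (\<lambda>x. f x * cnj (g x))"
    using f g by (rule integrable_mult_cnj_L2)
  \<comment> \<open>Conjugation commutes with the integral, so the mixed term integrates to
    \<open>?c\<close> times its own conjugate.\<close>
  have P: "has_bochner_integral (M \<Otimes>\<^sub>M M)
      (\<lambda>(x, y). (f x * cnj (g x)) * cnj (f y * cnj (g y))) (?c * cnj ?c)"
    using has_bochner_integral_product[OF C integrable_cnj[OF C]]
    by (simp only: Bochner_Integration.integral_cnj)
  have "has_bochner_integral (M \<Otimes>\<^sub>M M)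
      (\<lambda>z. (case z of (x, y) \<Rightarrow> (cmod (f x))\<^sup>2 * (cmod (g y))\<^sup>2)
        + (case z of (x, y) \<Rightarrow> (cmod (g x))\<^sup>2 * (cmod (f y))\<^sup>2)
        - 2 * Re (case z of (x, y) \<Rightarrow> (f x * cnj (g x)) * cnj (f y * cnj (g y))))
      ((\<integral>x. (cmod (f x))\<^sup>2 \<partial>M) * (\<integral>x. (cmod (g x))\<^sup>2 \<partial>M)
        + (\<integral>x. (cmod (g x))\<^sup>2 \<partial>M) * (\<integral>x. (cmod (f x))\<^sup>2 \<partial>M) - 2 * Re (?c * cnj ?c))"
    by (intro has_bochner_integral_add has_bochner_integral_diff has_bochner_integral_mult_right
        has_bochner_integral_product F G has_bochner_integral_bounded_linear[OF bounded_linear_Re P])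
  then have "(\<integral>(x, y). (cmod (f x * g y - g x * f y))\<^sup>2 \<partial>(M \<Otimes>\<^sub>M M)) =
      (\<integral>x. (cmod (f x))\<^sup>2 \<partial>M) * (\<integral>x. (cmod (g x))\<^sup>2 \<partial>M)
        + (\<integral>x. (cmod (g x))\<^sup>2 \<partial>M) * (\<integral>x. (cmod (f x))\<^sup>2 \<partial>M) - 2 * Re (?c * cnj ?c)"
    by (simp only: has_bochner_integral_iff case_prod_unfold cmod_cross_squared)
  moreover have "Re (?c * cnj ?c) = (cmod ?c)\<^sup>2"
    by (simp only: complex_norm_square[symmetric] Re_complex_of_real)
  ultimately show ?thesis
    by (simp add: algebra_simps del: times_complex.sel)
qed

lemma integral_cmod_combination_squared_ge:
  assumes f: "f \<in> L2_fun M" and g: "g \<in> L2_fun M"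
  shows "2 * cmod a * cmod b * (L2_norm M f * L2_norm M g - cmod (\<integral>x. f x * cnj (g x) \<partial>M))
    \<le> (\<integral>x. (cmod (a * f x + b * g x))\<^sup>2 \<partial>M)"
proof -
  let ?c = "\<integral>x. f x * cnj (g x) \<partial>M"
  have F: "integrable M (\<lambda>x. (cmod (f x))\<^sup>2)" and G: "integrable M (\<lambda>x. (cmod (g x))\<^sup>2)"
    using f g by (simp_all add: L2_fun_def)
  have C: "integrable M (\<lambda>x. f x * cnj (g x))"
    using f g by (rule integrable_mult_cnj_L2)
  \<comment> \<open>Side condition under which squaring \<open>L2_norm\<close> cancels its square
    root.\<close>
  have nonneg: "0 \<le> (\<integral>x. (cmod (h x))\<^sup>2 \<partial>M)" for h :: "'a \<Rightarrow> complex"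
    by simp
  have "(\<integral>x. (cmod (a * f x + b * g x))\<^sup>2 \<partial>M) = (\<integral>x. (cmod a)\<^sup>2 * (cmod (f x))\<^sup>2
      + (cmod b)\<^sup>2 * (cmod (g x))\<^sup>2 + 2 * Re (a * cnj b * (f x * cnj (g x))) \<partial>M)"
    by (simp only: cmod_add_squared norm_mult power_mult_distrib complex_cnj_mult mult_ac)
  also have "\<dots> = (cmod a)\<^sup>2 * (L2_norm M f)\<^sup>2 + (cmod b)\<^sup>2 * (L2_norm M g)\<^sup>2
      + 2 * Re (a * cnj b * ?c)"
    using F G C by (simp add: L2_norm_def nonneg del: times_complex.sel)
  \<comment> \<open>The phase of \<open>a * cnj b * ?c\<close> is arbitrary, so its real part is
    bounded below by minus its modulus.\<close>
  also have "\<dots> \<ge> (cmod a * L2_norm M f)\<^sup>2 + (cmod b * L2_norm M g)\<^sup>2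
      - 2 * (cmod a * cmod b * cmod ?c)"
    using abs_Re_le_cmod[of "a * cnj b * ?c"]
    by (simp add: norm_mult power_mult_distrib del: times_complex.sel)
  finally show ?thesis
    using sum_squares_bound[of "cmod a * L2_norm M f" "cmod b * L2_norm M g"]
    by (simp add: algebra_simps)
qed

theorem lemma1p2:
  fixes M :: "'a measure" and f\<^sub>1 f\<^sub>2 :: "'a \<Rightarrow> complex" and l\<^sub>1 l\<^sub>2 :: complex
  assumes "sigma_finite_measure M"
    and "f\<^sub>1 \<in> L2_fun M" and "f\<^sub>2 \<in> L2_fun M"
  shows "cmod l\<^sub>1 * cmod l\<^sub>2 / 2 *
      (\<integral>(x, y). (cmod (det (vector [vector [f\<^sub>1 x, f\<^sub>2 x], vector [f\<^sub>1 y, f\<^sub>2 y]] :: complex^2^2)))\<^sup>2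
        \<partial>(M \<Otimes>\<^sub>M M))
    \<le> L2_norm M f\<^sub>1 * L2_norm M f\<^sub>2 * (\<integral>x. (cmod (l\<^sub>1 * f\<^sub>1 x + l\<^sub>2 * f\<^sub>2 x))\<^sup>2 \<partial>M)"
proof -
  define s where "s = L2_norm M f\<^sub>1 * L2_norm M f\<^sub>2"
  define c where "c = cmod (\<integral>x. f\<^sub>1 x * cnj (f\<^sub>2 x) \<partial>M)"
  let ?D = "\<integral>(x, y). (cmod (f\<^sub>1 x * f\<^sub>2 y - f\<^sub>2 x * f\<^sub>1 y))\<^sup>2 \<partial>(M \<Otimes>\<^sub>M M)"
  have s: "0 \<le> s" and "0 \<le> c"
    by (simp_all add: s_def c_def L2_norm_def)
  have D: "?D = 2 * (s\<^sup>2 - c\<^sup>2)"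
    by (subst integral_cmod_cross_squared[OF assms])
      (simp add: s_def c_def L2_norm_def power_mult_distrib)
  have "0 \<le> ?D"
    by (rule integral_nonneg_AE) (simp add: case_prod_unfold)
  then have "c \<le> s"
    using D s by (auto intro: power2_le_imp_le)
  have "cmod l\<^sub>1 * cmod l\<^sub>2 / 2 * ?D = cmod l\<^sub>1 * cmod l\<^sub>2 * (s - c) * (s + c)"
    unfolding D by (simp add: power2_eq_square algebra_simps)
  \<comment> \<open>The inequality \<open>c \<le> s\<close> enters twice: it makes the factor
    \<open>s - c\<close> nonnegative and gives \<open>s + c \<le> 2 * s\<close>. The resulting
    \<open>2 * (s - c)\<close> is what the lower bound for the combination provides.\<close>
  also have "\<dots> \<le> cmod l\<^sub>1 * cmod l\<^sub>2 * (s - c) * (2 * s)"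
    using \<open>c \<le> s\<close> by (intro mult_left_mono) simp_all
  also have "\<dots> = s * (2 * cmod l\<^sub>1 * cmod l\<^sub>2 * (s - c))"
    by simp
  also have "\<dots> \<le> s * (\<integral>x. (cmod (l\<^sub>1 * f\<^sub>1 x + l\<^sub>2 * f\<^sub>2 x))\<^sup>2 \<partial>M)"
    using s integral_cmod_combination_squared_ge[OF assms(2,3)]
    unfolding s_def c_def by (intro mult_left_mono)
  finally show ?thesis
    by (simp add: det_2 s_def)
qed

end
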